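(* Let $X$ be a finite simple connected graph without vertices of degree one, let $T$ be a spanning tree of $X$, and let $\beta=\beta(X)=e(X)-v(X)+1$. Then either the homomorphism $\Theta_T\colon \operatorname{Aut}(X)\to U_\beta$, $f\mapsto M_T(f)$, is injective, or $X$ is a simple cycle.
   Context: Automorphisms are permutations of the vertices preserving adjacency; they act also on darts. A dart is an edge with one of its two orientations; $x^{-1}$ is the reverse of the dart $x$. A simple cycle is a connected graph in which every vertex has degree $2$. The representation: let $e_1,\dots,e_\beta$ be the edges of $X$ not in $T$, in a fixed order, where $\beta=e(X)-v(X)+1$, and for each $e_i$ choose one of its darts $x_i$. The fundamental oriented cycle $C_i$ is the oriented simple cycle formed by $x_i$ followed by the unique path in $T$ from the terminal vertex of $x_i$ to its initial vertex. The cycles $C_1,\dots,C_\beta$ form a basis of the free abelian group $H_1(X)=H_1(X,\mathbb{Z})$. For $f\in\operatorname{Aut}(X)$, $M_T(f)$ is the matrix, in this basis, of the linear map induced by $f$ on $H_1(X)$; its entry $m_{i,j}$ is $1$ if $f(C_j)$ traverses $x_i$, $-1$ if $f(C_j)$ traverses $x_i^{-1}$, and $0$ otherwise. $U_\beta$ is the group of $\beta\times\beta$ integer matrices of determinant $\pm1$ (trivial if $\beta=0$). The map $\Theta_T\colon f\mapsto M_T(f)$ is a group homomorphism $\operatorname{Aut}(X)\to U_\beta$. *)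

theory Defs
  imports
    "HOL-Combinatorics.Permutations"
    "HOL-Algebra.Group"
    "Graph_Theory.Graph_Theory"
    "Jordan_Normal_Form.Determinant"
begin

text \<open>
  A finite simple graph is a symmetric, loop-free digraph without parallel arcs (locale
  \<open>pair_graph\<close>). Its arcs are the darts of the graph, the reverse of \<open>(u, v)\<close> being \<open>(v, u)\<close>,
  and the degree of a vertex is its out-degree. The library's \<open>connected\<close> requires at least
  one vertex.
\<close>

definition edge_of :: "'a \<times> 'a \<Rightarrow> 'a set" where
  "edge_of d = {fst d, snd d}"

definition edges :: "'a pair_pre_digraph \<Rightarrow> 'a set set" where
  "edges G = edge_of ` parcs G"

text \<open>For connected \<open>G\<close> the truncated subtraction is exact.\<close>

definition betti :: "'a pair_pre_digraph \<Rightarrow> nat" where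
  "betti G = card (edges G) + 1 - card (pverts G)"

definition simple_cycle :: "'a pair_pre_digraph \<Rightarrow> bool" where
  "simple_cycle G \<longleftrightarrow> pair_graph G \<and> connected G \<and> (\<forall>v \<in> pverts G. out_degree G v = 2)"

text \<open>
  The library predicates \<open>forest\<close> and \<open>spanning_tree\<close> are unsuitable here: they exclude directed
  cycles, and in a symmetric digraph a dart followed by its reverse is a directed cycle of
  length two. The cycles of an undirected simple graph are those of length at least three.
\<close>

definition undirected_tree :: "'a pair_pre_digraph \<Rightarrow> bool" where
  "undirected_tree T \<longleftrightarrow>
     pair_graph T \<and> connected T \<and> \<not> (\<exists>p. pre_digraph.cycle T p \<and> length p \<ge> 3)"

definition undirected_spanning_tree :: "'a pair_pre_digraph \<Rightarrow> 'a pair_pre_digraph \<Rightarrow> bool" where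
  "undirected_spanning_tree T G \<longleftrightarrow> undirected_tree T \<and> spanning T G"

text \<open>
  \<open>x\<close> lists, for an enumeration \<open>e\<close> of the edges outside \<open>T\<close> by the indices \<open>i < betti G\<close>,
  one dart \<open>x i\<close> of each \<open>e i\<close>.
\<close>

definition cotree_darts ::
    "'a pair_pre_digraph \<Rightarrow> 'a pair_pre_digraph \<Rightarrow> (nat \<Rightarrow> 'a \<times> 'a) \<Rightarrow> bool" where
  "cotree_darts G T x \<longleftrightarrow>
     (\<forall>i < betti G. x i \<in> parcs G) \<and>
     bij_betw (\<lambda>i. edge_of (x i)) {..<betti G} (edges G - edges T)"


text \<open>
  A 1-chain with integer coefficients is given by its coefficient on each dart, the coefficients
  on a dart and on its reverse being opposite. As \<open>G\<close> has no 2-cells, the first homology group is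
  the group of 1-cycles. The boundary of the dart \<open>(u, v)\<close> is \<open>v - u\<close>, so the coefficient of
  \<open>v\<close> in the boundary of \<open>c\<close> is the sum of \<open>c\<close> over the darts ending in \<open>v\<close>.
\<close>

definition chains1 :: "'a pair_pre_digraph \<Rightarrow> ('a \<times> 'a \<Rightarrow> int) set" where
  "chains1 G = {c. (\<forall>d. d \<notin> parcs G \<longrightarrow> c d = 0) \<and> (\<forall>u v. c (v, u) = - c (u, v))}"

definition boundary1 :: "'a pair_pre_digraph \<Rightarrow> ('a \<times> 'a \<Rightarrow> int) \<Rightarrow> 'a \<Rightarrow> int" where
  "boundary1 G c v = (\<Sum>d \<in> in_arcs G v. c d)"

definition H1 :: "'a pair_pre_digraph \<Rightarrow> ('a \<times> 'a \<Rightarrow> int) set" where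
  "H1 G = {c \<in> chains1 G. \<forall>v \<in> pverts G. boundary1 G c v = 0}"

definition chain_of_walk :: "('a \<times> 'a) list \<Rightarrow> ('a \<times> 'a \<Rightarrow> int)" where
  "chain_of_walk p d = int (count_list p d) - int (count_list p (prod.swap d))"

definition tree_path :: "'a pair_pre_digraph \<Rightarrow> 'a \<Rightarrow> 'a \<Rightarrow> ('a \<times> 'a) list" where
  "tree_path T u v = (THE p. pre_digraph.apath T u p v)"

definition fundamental_cycle :: "'a pair_pre_digraph \<Rightarrow> 'a \<times> 'a \<Rightarrow> ('a \<times> 'a) list" where
  "fundamental_cycle T d = d # tree_path T (snd d) (fst d)"


definition aut_group :: "'a pair_pre_digraph \<Rightarrow> ('a \<Rightarrow> 'a) monoid" where
  "aut_group G =
     \<lparr>carrier = {f. f permutes pverts G \<and>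
        (\<forall>u \<in> pverts G. \<forall>v \<in> pverts G. (u, v) \<in> parcs G \<longleftrightarrow> (f u, f v) \<in> parcs G)},
      mult = (\<circ>), one = id\<rparr>"

definition U_group :: "nat \<Rightarrow> int mat monoid" where
  "U_group n =
     \<lparr>carrier = {A \<in> carrier_mat n n. det A = 1 \<or> det A = -1}, mult = (*), one = 1\<^sub>m n\<rparr>"

text \<open>
  The induced map sends a dart \<open>d\<close> to its image under \<open>f\<close>; hence the coefficient of the image of
  \<open>c\<close> on \<open>d\<close> is the coefficient of \<open>c\<close> on the preimage of \<open>d\<close>.
\<close>

definition H1_map :: "'a pair_pre_digraph \<Rightarrow> ('a \<Rightarrow> 'a) \<Rightarrow> ('a \<times> 'a \<Rightarrow> int) \<Rightarrow> ('a \<times> 'a \<Rightarrow> int)" where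
  "H1_map G f = (\<lambda>c \<in> H1 G. c \<circ> map_prod (Hilbert_Choice.inv f) (Hilbert_Choice.inv f))"

text \<open>
  The matrix of \<open>\<phi>\<close> in the basis \<open>b 0, \<dots>, b (n - 1)\<close>: column \<open>j\<close> holds the coordinates of
  \<open>\<phi> (b j)\<close>.
\<close>

definition matrix_in_basis ::
    "nat \<Rightarrow> (nat \<Rightarrow> 'd \<Rightarrow> int) \<Rightarrow> (('d \<Rightarrow> int) \<Rightarrow> ('d \<Rightarrow> int)) \<Rightarrow> int mat" where
  "matrix_in_basis n b \<phi> =
     (THE M. M \<in> carrier_mat n n \<and>
        (\<forall>j < n. \<phi> (b j) = (\<lambda>d. \<Sum>i < n. M $$ (i, j) * b i d)))"

definition Theta ::
    "'a pair_pre_digraph \<Rightarrow> 'a pair_pre_digraph \<Rightarrow> (nat \<Rightarrow> 'a \<times> 'a) \<Rightarrow> ('a \<Rightarrow> 'a) \<Rightarrow> int mat" where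
  "Theta G T x f =
     matrix_in_basis (betti G) (\<lambda>i. chain_of_walk (fundamental_cycle T (x i))) (H1_map G f)"

end

theory Submission
  imports Defs
begin

text \<open>
  The matrix of an automorphism determines its action on homology, because the fundamental cycles
  form a basis of \<open>H1 G\<close>. This rests on one fact about the tree: it carries no nonzero 1-cycle
  (\<open>H1_of_tree\<close>). The same fact makes tree paths unique, and it shows that a 1-cycle of the graph is
  determined by its coefficients on the darts \<open>x i\<close>; since the \<open>i\<close>-th fundamental cycle has
  coefficient 1 on \<open>x i\<close> and 0 on the others, those coefficients are the coordinates
  (\<open>H1_expansion\<close>). Functoriality of the action makes \<open>Theta\<close> multiplicative, and the matrices of an
  automorphism and of its inverse have product 1, so their determinants are units of the integers.

  For injectivity, equality of the matrices of \<open>f\<close> and \<open>g\<close> means that the automorphism \<open>h\<close>, the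
  inverse of \<open>g\<close> after \<open>f\<close>, acts trivially on homology. A map of a connected graph that is trivial
  on homology has Lefschetz number equal to the Euler characteristic, so the number of its fixed
  vertices, minus that of the edges fixed with their orientation, plus that of the edges it flips, is
  the number of all vertices minus that of all edges. Removing what is fixed from
  both sides, twice the number of moved vertices is the number of moved darts plus that of flipped
  darts (\<open>lefschetz_count\<close>). But every moved vertex has degree at least 2, and all darts that start
  in it are moved. This leaves no slack: the moved vertices all have degree 2, and no edge joins a
  moved vertex to a fixed one. As the graph is connected, either nothing is moved, or every vertex
  has degree 2 and the graph is a simple cycle (\<open>H1_trivial_imp_id_or_simple_cycle\<close>).
\<close>

section \<open>Walks in connected graphs\<close>

lemma (in pair_graph) connected_imp_apath:
  assumes "connected G" "u \<in> pverts G" "v \<in> pverts G"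
  shows "\<exists>p. apath u p v"
proof -
  have "strongly_connected G"
    using symmetric_connected_imp_strongly_connected[OF pair_sym_arcs assms(1)] .
  then show ?thesis
    using assms(2,3) by (auto simp: strongly_connected_def reachable_apath)
qed

text \<open>
  The form in which connectedness enters the counting argument: the moved vertices of an
  automorphism turn out to be closed under adjacency, so they are all vertices or none.
\<close>

lemma (in pair_graph) connected_closed_eq_verts:
  assumes "connected G" "W \<subseteq> pverts G" "W \<noteq> {}"
    and closed: "\<And>a b. (a, b) \<in> parcs G \<Longrightarrow> a \<in> W \<Longrightarrow> b \<in> W"
  shows "W = pverts G"
proof -
  obtain u where u: "u \<in> W" using \<open>W \<noteq> {}\<close> by auto
  have stays: "awalk a p b \<Longrightarrow> a \<in> W \<Longrightarrow> b \<in> W" for a b p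
    by (induction p arbitrary: a) (auto simp: awalk_simps dest: closed)
  have "v \<in> W" if "v \<in> pverts G" for v
    using connected_imp_apath[OF assms(1), of u v] u that assms(2) stays by (auto simp: apath_def)
  with assms(2) show ?thesis by auto
qed

lemma (in pair_graph) swap_in_parcs_iff [simp]: "prod.swap d \<in> parcs G \<longleftrightarrow> d \<in> parcs G"
proof (cases d)
  case (Pair a b)
  then show ?thesis using arcs_symmetric[of a b] arcs_symmetric[of b a] by auto
qed

lemma (in pair_graph) swap_neq_dart: "d \<in> parcs G \<Longrightarrow> prod.swap d \<noteq> d"
  using no_loops' by (cases d) auto

lemma edge_of_eq_iff: "edge_of d = edge_of e \<longleftrightarrow> d = e \<or> d = prod.swap e"
  by (cases d; cases e) (auto simp: edge_of_def doubleton_eq_iff)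

lemma (in pair_graph) edge_of_in_edges_iff: "edge_of d \<in> edges G \<longleftrightarrow> d \<in> parcs G"
  using arcs_symmetric by (auto simp: edges_def edge_of_eq_iff)

section \<open>Chains and cycles\<close>

lemma chain_of_walk_Nil [simp]: "chain_of_walk [] e = 0"
  by (simp add: chain_of_walk_def)

lemma chain_of_walk_Cons:
  "chain_of_walk (d # p) e = of_bool (e = d) - of_bool (e = prod.swap d) + chain_of_walk p e"
proof -
  have "d = prod.swap e \<longleftrightarrow> e = prod.swap d" by (metis swap_swap)
  then show ?thesis by (auto simp: chain_of_walk_def simp del: prod.swap_def)
qed

lemma chain_of_walk_eq_0: "e \<notin> set p \<Longrightarrow> prod.swap e \<notin> set p \<Longrightarrow> chain_of_walk p e = 0"
  by (simp add: chain_of_walk_def count_list_0_iff)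

lemma chain_of_walk_append: "chain_of_walk (p @ q) e = chain_of_walk p e + chain_of_walk q e"
  by (simp add: chain_of_walk_def)

lemma (in pair_graph) sum_of_bool_in_arcs:
  assumes "d \<in> parcs G"
  shows "(\<Sum>e\<in>in_arcs G y. of_bool (e = d) :: int) = of_bool (snd d = y)"
proof -
  have "(\<Sum>e\<in>in_arcs G y. of_bool (e = d) :: int) = (\<Sum>e\<in>in_arcs G y. if e = d then 1 else 0)"
    by (rule sum.cong) auto
  also have "\<dots> = (if d \<in> in_arcs G y then 1 else 0)"
    using finite_in_arcs by (rule sum.delta)
  finally show ?thesis using assms by (simp add: in_arcs_def)
qed

lemma (in pair_graph) boundary1_chain_of_walk:
  assumes "awalk u p v"
  shows "boundary1 G (chain_of_walk p) y = of_bool (y = v) - of_bool (y = u)"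
  using assms
proof (induction p arbitrary: u)
  case Nil
  then show ?case by (simp add: boundary1_def awalk_Nil_iff)
next
  case (Cons d p)
  then have d: "d \<in> parcs G" "u = fst d" and p: "awalk (snd d) p v"
    by (auto simp: awalk_Cons_iff)
  have "boundary1 G (chain_of_walk (d # p)) y =
      (\<Sum>e\<in>in_arcs G y. of_bool (e = d)) - (\<Sum>e\<in>in_arcs G y. of_bool (e = prod.swap d))
        + boundary1 G (chain_of_walk p) y"
    by (simp only: boundary1_def chain_of_walk_Cons sum.distrib sum_subtractf)
  also have "\<dots> = of_bool (snd d = y) - of_bool (fst d = y) + (of_bool (y = v) - of_bool (y = snd d))"
    using sum_of_bool_in_arcs[of d y] sum_of_bool_in_arcs[of "prod.swap d" y] d(1)
    by (simp only: Cons.IH[OF p] swap_in_parcs_iff snd_swap)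
  finally show ?case using d(2) by (simp add: eq_commute[of y])
qed

lemma chains1_swap:
  assumes "c \<in> chains1 G"
  shows "c (prod.swap d) = - c d"
proof (cases d)
  case (Pair u v)
  have "c (v, u) = - c (u, v)" using assms unfolding chains1_def by blast
  with Pair show ?thesis by simp
qed

lemma chains1_eq_0: "c \<in> chains1 G \<Longrightarrow> d \<notin> parcs G \<Longrightarrow> c d = 0"
  unfolding chains1_def by blast

lemma chains1I:
  assumes "\<And>d. d \<notin> parcs G \<Longrightarrow> c d = 0" "\<And>d. c (prod.swap d) = - c d"
  shows "c \<in> chains1 G"
proof -
  have "c (v, u) = - c (u, v)" for u v
    using assms(2)[of "(u, v)"] by (simp only: prod.swap_def fst_conv snd_conv)
  with assms(1) show ?thesis unfolding chains1_def by blast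
qed

lemma (in pair_graph) chain_of_walk_in_chains1:
  assumes "set p \<subseteq> parcs G"
  shows "chain_of_walk p \<in> chains1 G"
proof (rule chains1I)
  fix d
  show "chain_of_walk p d = 0" if "d \<notin> parcs G"
    using that assms swap_in_parcs_iff[of d] by (intro chain_of_walk_eq_0) blast+
  show "chain_of_walk p (prod.swap d) = - chain_of_walk p d"
    by (simp add: chain_of_walk_def)
qed

lemma H1_imp_chains1: "c \<in> H1 G \<Longrightarrow> c \<in> chains1 G"
  by (simp add: H1_def)

lemma (in pair_graph) closed_walk_in_H1: "awalk u p u \<Longrightarrow> chain_of_walk p \<in> H1 G"
  by (auto simp: H1_def boundary1_chain_of_walk intro!: chain_of_walk_in_chains1)

lemma H1I:
  assumes "c \<in> chains1 G" "\<And>v. v \<in> pverts G \<Longrightarrow> boundary1 G c v = 0"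
  shows "c \<in> H1 G"
  using assms by (simp add: H1_def)

lemma H1_boundary: "c \<in> H1 G \<Longrightarrow> v \<in> pverts G \<Longrightarrow> boundary1 G c v = 0"
  by (simp add: H1_def)

lemma chains1_diff:
  assumes "a \<in> chains1 G" "b \<in> chains1 G"
  shows "(\<lambda>d. a d - b d) \<in> chains1 G"
  using assms[THEN chains1_eq_0] assms[THEN chains1_swap] by (intro chains1I) simp_all

lemma boundary1_diff: "boundary1 G (\<lambda>d. a d - b d) v = boundary1 G a v - boundary1 G b v"
  by (simp add: boundary1_def sum_subtractf)

lemma H1_diff:
  assumes "a \<in> H1 G" "b \<in> H1 G"
  shows "(\<lambda>d. a d - b d) \<in> H1 G"
  using assms by (intro H1I) (simp_all add: chains1_diff H1_imp_chains1 boundary1_diff H1_boundary)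

lemma (in pair_graph) walks_with_same_ends_in_H1:
  assumes "awalk u p v" "awalk u q v"
  shows "(\<lambda>d. chain_of_walk p d - chain_of_walk q d) \<in> H1 G"
  using assms
  by (intro H1I chains1_diff chain_of_walk_in_chains1)
    (auto simp: boundary1_diff boundary1_chain_of_walk)

lemma H1_linear_combination:
  assumes "\<And>i. i \<in> I \<Longrightarrow> b i \<in> H1 G"
  shows "(\<lambda>d. \<Sum>i\<in>I. a i * b i d) \<in> H1 G"
proof (intro H1I chains1I)
  fix d
  show "(\<Sum>i\<in>I. a i * b i d) = 0" if "d \<notin> parcs G"
    using assms[THEN H1_imp_chains1, THEN chains1_eq_0, OF _ that] by simp
  have "b i (prod.swap d) = - b i d" if "i \<in> I" for i
    using chains1_swap[OF H1_imp_chains1[OF assms[OF that]]] .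
  then show "(\<Sum>i\<in>I. a i * b i (prod.swap d)) = - (\<Sum>i\<in>I. a i * b i d)"
    by (simp add: sum_negf)
next
  fix v assume "v \<in> pverts G"
  have "boundary1 G (\<lambda>d. \<Sum>i\<in>I. a i * b i d) v = (\<Sum>i\<in>I. a i * boundary1 G (b i) v)"
    unfolding boundary1_def by (subst sum.swap) (simp add: sum_distrib_left)
  also have "\<dots> = 0"
    using assms \<open>v \<in> pverts G\<close> by (simp add: H1_boundary)
  finally show "boundary1 G (\<lambda>d. \<Sum>i\<in>I. a i * b i d) v = 0" .
qed

section \<open>Trees carry no cycles\<close>

text \<open>
  A closed walk in the directed graph \<open>R\<close> contains a directed cycle. Loops are excluded, and a
  cycle of length two would consist of a dart and its reverse, which \<open>R\<close> does not contain
  together; so the cycle has length at least three.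
\<close>

lemma (in pair_graph) acyclic_of_no_long_cycle:
  assumes no_cycle: "\<not> (\<exists>p. cycle p \<and> length p \<ge> 3)"
    and R: "R \<subseteq> parcs G"
    and oriented: "\<And>d. d \<in> R \<Longrightarrow> prod.swap d \<notin> R"
  shows "acyclic R"
proof (rule acyclicI, intro allI notI)
  fix a assume a: "(a, a) \<in> R\<^sup>+"
  define P where "P = \<lparr>pverts = pverts G, parcs = R\<rparr>"
  interpret P: pair_wf_digraph P
    using R wellformed' by unfold_locales (auto simp: P_def)
  have "\<exists>p. P.awalk a p a \<and> p \<noteq> []"
    using a P.reachable1_awalk[of a a] by (simp add: P_def)
  then obtain p where p: "P.cycle p"
    using P.closed_w_imp_cycle unfolding P.closed_w_def by blast
  then obtain u where u: "P.awalk u p u" "distinct (tl (pawalk_verts u p))" "p \<noteq> []"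
    by (auto simp: P.cycle_def)
  then have "awalk u p u"
    using R by (auto simp: awalk_def P.awalk_def) (auto simp: P_def)
  with u have "cycle p" by (auto simp: cycle_def)
  moreover have "length p \<ge> 3"
  proof (rule ccontr)
    assume "\<not> length p \<ge> 3"
    with u(3) consider d where "p = [d]" | d e where "p = [d, e]"
      by (cases p rule: remdups_adj.cases) (auto simp: not_le Suc_le_eq less_Suc_eq)
    then show False
    proof cases
      case 1
      then have "d \<in> parcs G" "fst d = snd d"
        using \<open>awalk u p u\<close> by (simp_all add: awalk_simps)
      then show False using pair_no_loops by blast
    next
      case 2
      then have "d \<in> parcs P" "e \<in> parcs P" "fst e = snd d" "snd e = fst d"
        using u(1) by (simp_all add: P.awalk_simps)
      then have "d \<in> R" "prod.swap d \<in> R"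
        by (simp_all add: P_def prod.swap_def prod_eq_iff) (metis prod.collapse)
      then show False using oriented by blast
    qed
  qed
  ultimately show False using no_cycle by auto
qed

text \<open>
  Follow the darts on which \<open>c\<close> is positive. Where one of them enters a vertex, the vanishing
  boundary forces another one to leave it, and never along the reverse of a positive dart. In a
  finite graph such a journey closes up to a cycle of length at least three. The proof reads this
  backwards: without cycles the relation of positive darts has a last vertex, and there the
  boundary is positive.
\<close>

lemma H1_of_tree:
  assumes "undirected_tree T" "c \<in> H1 T"
  shows "c d = 0"
proof (rule ccontr)
  interpret T: pair_graph T using assms(1) by (simp add: undirected_tree_def)
  have c: "c \<in> chains1 T" using assms(2) by (rule H1_imp_chains1)
  assume "c d \<noteq> 0"
  define R where "R = {e \<in> parcs T. c e > 0}"
  have "d \<in> parcs T" using chains1_eq_0[OF c] \<open>c d \<noteq> 0\<close> by blast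
  then have "d \<in> R \<or> prod.swap d \<in> R"
    using \<open>c d \<noteq> 0\<close> chains1_swap[OF c, of d] by (auto simp: R_def)
  then have "Range R \<noteq> {}" by (metis Range_iff empty_iff surj_pair)
  have "acyclic R"
    using assms(1) chains1_swap[OF c]
    by (intro T.acyclic_of_no_long_cycle) (auto simp: R_def undirected_tree_def)
  moreover have "finite R" using T.pair_finite_arcs by (auto simp: R_def)
  ultimately have "wf (R\<inverse>)" by (simp add: finite_acyclic_wf_converse)
  with \<open>Range R \<noteq> {}\<close> obtain z where z: "z \<in> Range R" "\<And>y. (z, y) \<in> R \<Longrightarrow> y \<notin> Range R"
    by (metis converse_iff ex_in_conv wfE_min)
  then have no_out: "(z, y) \<notin> R" for y by auto
  have nonneg: "c e \<ge> 0" if "e \<in> in_arcs T z" for e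
    using that no_out[of "fst e"] chains1_swap[OF c, of e] T.swap_in_parcs_iff[of e]
    by (cases e) (auto simp: R_def in_arcs_def)
  obtain y where y: "(y, z) \<in> R" using z(1) by auto
  then have "(y, z) \<in> in_arcs T z" "c (y, z) > 0" by (auto simp: R_def in_arcs_def)
  then have "boundary1 T c z > 0"
    unfolding boundary1_def using nonneg T.finite_in_arcs by (intro sum_pos2) auto
  moreover have "z \<in> pverts T" using y T.wellformed' by (auto simp: R_def)
  ultimately show False using H1_boundary[OF assms(2)] by auto
qed

text \<open>
  A path does not return to its first vertex, so there no later dart contributes to the chain.
\<close>

lemma (in pair_graph) chain_of_apath_at_first_vertex:
  assumes "apath u (d # p) v" "fst e = u"
  shows "chain_of_walk (d # p) e = of_bool (e = d)"
proof -
  have d: "d \<in> parcs G" "fst d = u" "awalk (snd d) p v" "u \<notin> set (pawalk_verts (snd d) p)"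
    using assms(1) by (auto simp: apath_def awalk_Cons_iff)
  have "e \<notin> set p"
    using awalk_verts_arc1[of e p "snd d"] d assms(2) by auto
  moreover have "prod.swap e \<notin> set p"
    using awalk_verts_arc2[OF d(3), of "prod.swap e"] d assms(2) by auto
  moreover have "e \<noteq> prod.swap d"
    using d assms(2) pair_no_loops[of d] by auto
  ultimately show ?thesis by (simp add: chain_of_walk_Cons chain_of_walk_eq_0)
qed

text \<open>
  Two paths with the same ends differ by a 1-cycle of the tree, so they have the same chain. A path
  can be recovered from its chain: the only dart out of the initial vertex with a nonzero
  coefficient is its first dart, and the rest follows by induction.
\<close>

lemma tree_apath_unique:
  assumes "undirected_tree T" "pre_digraph.apath T u p v" "pre_digraph.apath T u q v"
  shows "p = q"
proof -
  interpret T: pair_graph T using assms(1) by (simp add: undirected_tree_def)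
  have same_chain: "chain_of_walk p = chain_of_walk q"
    if "T.apath u p v" "T.apath u q v" for u p q
  proof
    fix d
    have "(\<lambda>d. chain_of_walk p d - chain_of_walk q d) \<in> H1 T"
      using that by (auto intro: T.walks_with_same_ends_in_H1 simp: T.apath_def)
    from H1_of_tree[OF assms(1) this] show "chain_of_walk p d = chain_of_walk q d"
      by (auto dest: spec[of _ d])
  qed
  show ?thesis
    using assms(2,3)
  proof (induction p arbitrary: u q)
    case Nil
    then show ?case using T.apath_nonempty_ends by (metis T.apath_Nil_iff)
  next
    case (Cons d p)
    then have "q \<noteq> []" using T.apath_nonempty_ends by (metis T.apath_Nil_iff list.distinct(1))
    then obtain e q' where q: "q = e # q'" by (cases q) auto
    have "fst d = u" using Cons.prems by (simp add: T.apath_Cons_iff)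
    then have "of_bool (d = d) = (of_bool (d = e) :: int)"
      using same_chain[OF Cons.prems] Cons.prems
        T.chain_of_apath_at_first_vertex[of u d p v d] T.chain_of_apath_at_first_vertex[of u e q' v d]
      by (simp add: q)
    then have "d = e" by simp
    with Cons q show ?case by (auto simp: T.apath_Cons_iff)
  qed
qed

lemma apath_tree_path:
  assumes "undirected_tree T" "u \<in> pverts T" "v \<in> pverts T"
  shows "pre_digraph.apath T u (tree_path T u v) v"
proof -
  interpret T: pair_graph T using assms(1) by (simp add: undirected_tree_def)
  obtain p where "T.apath u p v"
    using T.connected_imp_apath assms unfolding undirected_tree_def by blast
  moreover have "q = p" if "T.apath u q v" "T.apath u p v" for p q
    using assms(1) that by (rule tree_apath_unique)
  ultimately show ?thesis unfolding tree_path_def by (metis theI)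
qed

section \<open>The basis of fundamental cycles\<close>

locale graph_with_cotree_darts = pair_graph G for G :: "'a pair_pre_digraph" +
  fixes T :: "'a pair_pre_digraph" and x :: "nat \<Rightarrow> 'a \<times> 'a"
  assumes spanning_tree: "undirected_spanning_tree T G"
    and cotree: "cotree_darts G T x"
begin

abbreviation cyc :: "nat \<Rightarrow> 'a \<times> 'a \<Rightarrow> int" where
  "cyc i \<equiv> chain_of_walk (fundamental_cycle T (x i))"

lemma tree: "undirected_tree T"
  using spanning_tree by (simp add: undirected_spanning_tree_def)

sublocale T: pair_graph T
  using tree by (simp add: undirected_tree_def)

lemma verts_T: "pverts T = pverts G" and arcs_T: "parcs T \<subseteq> parcs G"
  using spanning_tree by (auto simp: undirected_spanning_tree_def spanning_def subgraph_def)

lemma x_in_parcs: "i < betti G \<Longrightarrow> x i \<in> parcs G"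
  using cotree by (simp add: cotree_darts_def)

lemma x_notin_T: "i < betti G \<Longrightarrow> x i \<notin> parcs T"
  using cotree T.edge_of_in_edges_iff[of "x i"]
  unfolding cotree_darts_def by (auto dest: bij_betwE)

lemma x_inj:
  assumes "i < betti G" "j < betti G" "x j = x i \<or> x j = prod.swap (x i)"
  shows "j = i"
proof -
  have "inj_on (\<lambda>i. edge_of (x i)) {..<betti G}"
    using cotree unfolding cotree_darts_def by (auto dest: bij_betw_imp_inj_on)
  moreover have "edge_of (x j) = edge_of (x i)"
    using assms(3) by (simp only: edge_of_eq_iff)
  ultimately show ?thesis using assms(1,2) by (auto dest: inj_onD)
qed

lemma dart_cases:
  assumes "d \<in> parcs G" "d \<notin> parcs T"
  obtains i where "i < betti G" "d = x i \<or> d = prod.swap (x i)"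
proof -
  have "edge_of d \<in> edges G - edges T"
    using assms T.edge_of_in_edges_iff edge_of_in_edges_iff by auto
  also have "\<dots> = (\<lambda>i. edge_of (x i)) ` {..<betti G}"
    using cotree unfolding cotree_darts_def by (auto dest: bij_betw_imp_surj_on)
  finally obtain i where "i < betti G" "edge_of d = edge_of (x i)" by auto
  with that show ?thesis by (simp only: edge_of_eq_iff)
qed

lemma tree_path_awalk:
  assumes "i < betti G"
  shows "T.awalk (snd (x i)) (tree_path T (snd (x i)) (fst (x i))) (fst (x i))"
proof -
  have "fst (x i) \<in> pverts T" "snd (x i) \<in> pverts T"
    using x_in_parcs[OF assms] arc_fst_in_verts arc_snd_in_verts verts_T by auto
  then show ?thesis using apath_tree_path[OF tree] T.awalkI_apath by blast
qed

lemma cyc_in_H1: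
  assumes "i < betti G"
  shows "cyc i \<in> H1 G"
proof (rule closed_walk_in_H1)
  let ?p = "tree_path T (snd (x i)) (fst (x i))"
  have "awalk (snd (x i)) ?p (fst (x i))"
    using tree_path_awalk[OF assms] arcs_T verts_T by (auto simp: awalk_def T.awalk_def)
  then show "awalk (fst (x i)) (fundamental_cycle T (x i)) (fst (x i))"
    using x_in_parcs[OF assms] by (simp add: fundamental_cycle_def awalk_Cons_iff)
qed

text \<open>
  The coefficients on the cotree darts are coordinates dual to the fundamental cycles, because the
  cycle of \<open>x i\<close> leaves the tree only in \<open>x i\<close>. This gives the linear independence, and turns
  matrix entries into coefficients.
\<close>

lemma cyc_at_x:
  assumes "i < betti G" "j < betti G"
  shows "cyc i (x j) = of_bool (i = j)"
proof -
  let ?p = "tree_path T (snd (x i)) (fst (x i))"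
  have "set ?p \<subseteq> parcs T" using tree_path_awalk[OF assms(1)] by (simp add: T.awalk_def)
  then have "chain_of_walk ?p (x j) = 0"
    using x_notin_T[OF assms(2)] T.swap_in_parcs_iff[of "x j"] by (intro chain_of_walk_eq_0) blast+
  moreover have "x j \<noteq> prod.swap (x i)"
    using x_inj[OF assms] swap_neq_dart[OF x_in_parcs[OF assms(1)]] by metis
  moreover have "x j = x i \<longleftrightarrow> i = j" using x_inj[OF assms] by blast
  ultimately show ?thesis by (simp only: fundamental_cycle_def chain_of_walk_Cons) simp
qed

text \<open>
  A cycle that avoids every edge outside the tree is a cycle of the tree, hence zero.
\<close>

lemma H1_eq_0_of_cotree_coefficients:
  assumes c: "c \<in> H1 G" and x: "\<And>i. i < betti G \<Longrightarrow> c (x i) = 0"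
  shows "c d = 0"
proof -
  have ch: "c \<in> chains1 G" using c by (rule H1_imp_chains1)
  have off_T: "c d = 0" if off: "d \<notin> parcs T" for d
  proof (cases "d \<in> parcs G")
    case True
    obtain i where "i < betti G" "d = x i \<or> d = prod.swap (x i)"
      using dart_cases[OF True off] by blast
    then show ?thesis using x[of i] chains1_swap[OF ch, of "x i"] by auto
  next
    case False
    then show ?thesis using chains1_eq_0[OF ch] by blast
  qed
  have "boundary1 T c v = boundary1 G c v" for v
    unfolding boundary1_def
    by (rule sum.mono_neutral_left) (use arcs_T off_T in \<open>auto simp: in_arcs_def pair_finite_arcs\<close>)
  then have "c \<in> H1 T"
    using off_T chains1_swap[OF ch] H1_boundary[OF c] verts_T by (intro H1I chains1I) simp_all
  then show ?thesis using H1_of_tree[OF tree] by blast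
qed

lemma H1_expansion:
  assumes c: "c \<in> H1 G"
  shows "c = (\<lambda>d. \<Sum>i<betti G. c (x i) * cyc i d)"
proof
  fix d
  let ?s = "\<lambda>d. \<Sum>i<betti G. c (x i) * cyc i d"
  have "(\<lambda>d. c d - ?s d) \<in> H1 G"
    using c by (intro H1_diff H1_linear_combination) (simp_all add: cyc_in_H1)
  moreover have "c (x j) - ?s (x j) = 0" if "j < betti G" for j
    using that by (simp add: cyc_at_x)
  ultimately have "c d - ?s d = 0" by (rule H1_eq_0_of_cotree_coefficients)
  then show "c d = ?s d" by simp
qed

text \<open>
  Expanding \<open>\<phi> (cyc j)\<close> in the basis and reading off its coefficient on \<open>x i\<close> determines the matrix
  entry; in particular the definite description in \<open>matrix_in_basis\<close> denotes.
\<close>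

lemma matrix_in_basis_eq:
  assumes "\<And>j. j < betti G \<Longrightarrow> \<phi> (cyc j) \<in> H1 G"
  shows "matrix_in_basis (betti G) cyc \<phi> = mat (betti G) (betti G) (\<lambda>(i, j). \<phi> (cyc j) (x i))"
  unfolding matrix_in_basis_def
proof (rule the_equality)
  show "mat (betti G) (betti G) (\<lambda>(i, j). \<phi> (cyc j) (x i)) \<in> carrier_mat (betti G) (betti G) \<and>
    (\<forall>j<betti G. \<phi> (cyc j) =
      (\<lambda>d. \<Sum>i<betti G. mat (betti G) (betti G) (\<lambda>(i, j). \<phi> (cyc j) (x i)) $$ (i, j) * cyc i d))"
  proof (intro conjI allI impI)
    fix j assume j: "j < betti G"
    show "\<phi> (cyc j) =
      (\<lambda>d. \<Sum>i<betti G. mat (betti G) (betti G) (\<lambda>(i, j). \<phi> (cyc j) (x i)) $$ (i, j) * cyc i d)"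
      using H1_expansion[OF assms[OF j]] j by simp
  qed simp
next
  fix M
  assume M: "M \<in> carrier_mat (betti G) (betti G) \<and>
    (\<forall>j<betti G. \<phi> (cyc j) = (\<lambda>d. \<Sum>i<betti G. M $$ (i, j) * cyc i d))"
  show "M = mat (betti G) (betti G) (\<lambda>(i, j). \<phi> (cyc j) (x i))"
  proof (rule eq_matI)
    fix i j
    assume "i < dim_row (mat (betti G) (betti G) (\<lambda>(i, j). \<phi> (cyc j) (x i)))"
      and "j < dim_col (mat (betti G) (betti G) (\<lambda>(i, j). \<phi> (cyc j) (x i)))"
    then have ij: "i < betti G" "j < betti G" by simp_all
    then have "\<phi> (cyc j) (x i) = (\<Sum>k<betti G. M $$ (k, j) * cyc k (x i))"
      using M by metis
    then show "M $$ (i, j) = mat (betti G) (betti G) (\<lambda>(i, j). \<phi> (cyc j) (x i)) $$ (i, j)"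
      using ij by (simp add: cyc_at_x)
  qed (use M in auto)
qed

end

section \<open>The action of the automorphism group\<close>

lemma (in pair_graph) aut_parcs_iff:
  assumes "f \<in> carrier (aut_group G)"
  shows "map_prod f f d \<in> parcs G \<longleftrightarrow> d \<in> parcs G"
proof -
  obtain u v where d: "d = (u, v)" by (cases d)
  have f: "f permutes pverts G"
    "\<And>u v. u \<in> pverts G \<Longrightarrow> v \<in> pverts G \<Longrightarrow> (u, v) \<in> parcs G \<longleftrightarrow> (f u, f v) \<in> parcs G"
    using assms by (auto simp: aut_group_def)
  show ?thesis
    using f(2)[of u v] wellformed' permutes_in_image[OF f(1)] unfolding d map_prod_simp by metis
qed

lemma aut_permutes: "f \<in> carrier (aut_group G) \<Longrightarrow> f permutes pverts G"
  by (simp add: aut_group_def)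

lemma (in pair_graph) autI:
  assumes "f permutes pverts G" "\<And>d. map_prod f f d \<in> parcs G \<longleftrightarrow> d \<in> parcs G"
  shows "f \<in> carrier (aut_group G)"
  using assms(1) assms(2)[of "(u, v)" for u v] by (simp add: aut_group_def)

lemma (in pair_graph) aut_inv:
  assumes "f \<in> carrier (aut_group G)"
  shows "Hilbert_Choice.inv f \<in> carrier (aut_group G)"
proof (rule autI)
  show "Hilbert_Choice.inv f permutes pverts G"
    using aut_permutes[OF assms] by (rule permutes_inv)
  fix d
  have "map_prod f f (map_prod (Hilbert_Choice.inv f) (Hilbert_Choice.inv f) d) = d"
    using permutes_inverses(1)[OF aut_permutes[OF assms]] by (cases d) simp
  then show "map_prod (Hilbert_Choice.inv f) (Hilbert_Choice.inv f) d \<in> parcs G \<longleftrightarrow> d \<in> parcs G"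
    using aut_parcs_iff[OF assms, of "map_prod (Hilbert_Choice.inv f) (Hilbert_Choice.inv f) d"]
    by simp
qed

lemma (in pair_graph) aut_comp:
  assumes "f \<in> carrier (aut_group G)" "g \<in> carrier (aut_group G)"
  shows "f \<circ> g \<in> carrier (aut_group G)"
proof (rule autI)
  show "f \<circ> g permutes pverts G"
    using aut_permutes[OF assms(2)] aut_permutes[OF assms(1)] by (rule permutes_compose)
  fix d
  show "map_prod (f \<circ> g) (f \<circ> g) d \<in> parcs G \<longleftrightarrow> d \<in> parcs G"
    using aut_parcs_iff[OF assms(1), of "map_prod g g d"] aut_parcs_iff[OF assms(2), of d]
    by (simp add: prod.map_comp)
qed

lemma (in pair_graph) boundary1_pullback:
  assumes "f \<in> carrier (aut_group G)"
  shows "boundary1 G (c \<circ> map_prod f f) v = boundary1 G c (f v)"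
proof -
  have bij: "bij f" using aut_permutes[OF assms] by (rule permutes_bij)
  have inj: "inj (map_prod f f)" using bij by (simp add: bij_is_inj prod.inj_map)
  have "map_prod f f ` in_arcs G v = in_arcs G (f v)"
  proof (intro equalityI subsetI)
    fix e assume "e \<in> in_arcs G (f v)"
    moreover obtain d where "e = map_prod f f d"
      using permutes_inverses(1)[OF aut_permutes[OF assms]] by (metis map_prod_simp surj_pair)
    ultimately show "e \<in> map_prod f f ` in_arcs G v"
      using aut_parcs_iff[OF assms] bij by (auto simp: in_arcs_def bij_is_inj inj_eq)
  qed (use aut_parcs_iff[OF assms] in \<open>auto simp: in_arcs_def\<close>)
  moreover have "sum c (map_prod f f ` in_arcs G v) = (\<Sum>d\<in>in_arcs G v. c (map_prod f f d))"
    using inj by (simp add: sum.reindex inj_on_subset)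
  ultimately show ?thesis by (simp add: boundary1_def)
qed

lemma (in pair_graph) pullback_in_H1:
  assumes "f \<in> carrier (aut_group G)" "c \<in> H1 G"
  shows "c \<circ> map_prod f f \<in> H1 G"
proof (intro H1I chains1I)
  have ch: "c \<in> chains1 G" using assms(2) by (rule H1_imp_chains1)
  fix d
  show "(c \<circ> map_prod f f) d = 0" if "d \<notin> parcs G"
    using chains1_eq_0[OF ch, of "map_prod f f d"] aut_parcs_iff[OF assms(1)] that by simp
  have "map_prod f f (prod.swap d) = prod.swap (map_prod f f d)" by (cases d) simp
  then show "(c \<circ> map_prod f f) (prod.swap d) = - (c \<circ> map_prod f f) d"
    using chains1_swap[OF ch, of "map_prod f f d"] by (simp only: comp_apply)
next
  fix v assume "v \<in> pverts G"
  then show "boundary1 G (c \<circ> map_prod f f) v = 0"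
    using permutes_in_image[OF aut_permutes[OF assms(1)]] H1_boundary[OF assms(2)]
    by (simp only: boundary1_pullback[OF assms(1)])
qed

lemma (in pair_graph) H1_map_in_H1:
  assumes "f \<in> carrier (aut_group G)" "c \<in> H1 G"
  shows "H1_map G f c \<in> H1 G"
  using pullback_in_H1[OF aut_inv[OF assms(1)] assms(2)] assms(2) by (simp add: H1_map_def)

lemma (in pair_graph) H1_map_comp:
  assumes "f \<in> carrier (aut_group G)" "g \<in> carrier (aut_group G)" "c \<in> H1 G"
  shows "H1_map G (f \<circ> g) c = H1_map G f (H1_map G g c)"
proof -
  have "Hilbert_Choice.inv (f \<circ> g) = Hilbert_Choice.inv g \<circ> Hilbert_Choice.inv f"
    using assms(1,2) by (intro o_inv_distrib permutes_bij[OF aut_permutes])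
  then show ?thesis
    using assms H1_map_in_H1[OF assms(2,3)] by (simp add: H1_map_def comp_assoc map_prod.comp)
qed

lemma H1_map_id: "c \<in> H1 G \<Longrightarrow> H1_map G id c = c"
  by (simp add: H1_map_def map_prod.id)

lemma (in pair_graph) id_in_aut: "id \<in> carrier (aut_group G)"
  by (rule autI) (simp_all add: permutes_id map_prod.id)

context graph_with_cotree_darts
begin

lemma Theta_eq:
  assumes "f \<in> carrier (aut_group G)"
  shows "Theta G T x f = mat (betti G) (betti G) (\<lambda>(i, j). H1_map G f (cyc j) (x i))"
  unfolding Theta_def using assms by (intro matrix_in_basis_eq H1_map_in_H1 cyc_in_H1)

lemma H1_map_expansion:
  assumes "f \<in> carrier (aut_group G)" "c \<in> H1 G"
  shows "H1_map G f c d = (\<Sum>k<betti G. c (x k) * H1_map G f (cyc k) d)"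
proof -
  let ?e = "map_prod (Hilbert_Choice.inv f) (Hilbert_Choice.inv f) d"
  have "H1_map G f c d = c ?e" using assms(2) by (simp add: H1_map_def)
  also have "\<dots> = (\<Sum>k<betti G. c (x k) * cyc k ?e)"
    using fun_cong[OF H1_expansion[OF assms(2)], of ?e] .
  also have "\<dots> = (\<Sum>k<betti G. c (x k) * H1_map G f (cyc k) d)"
    by (intro sum.cong) (simp_all add: H1_map_def cyc_in_H1)
  finally show ?thesis .
qed

lemma Theta_comp:
  assumes f: "f \<in> carrier (aut_group G)" and g: "g \<in> carrier (aut_group G)"
  shows "Theta G T x (f \<circ> g) = Theta G T x f * Theta G T x g"
proof (rule eq_matI)
  fix i j
  assume "i < dim_row (Theta G T x f * Theta G T x g)" "j < dim_col (Theta G T x f * Theta G T x g)"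
  then have ij: "i < betti G" "j < betti G" by (simp_all add: Theta_eq[OF f] Theta_eq[OF g])
  let ?c = "H1_map G g (cyc j)"
  have "?c \<in> H1 G" using H1_map_in_H1[OF g] cyc_in_H1 ij by blast
  then have "H1_map G (f \<circ> g) (cyc j) (x i) = (\<Sum>k<betti G. ?c (x k) * H1_map G f (cyc k) (x i))"
    using H1_map_expansion[OF f, of ?c] H1_map_comp[OF f g] cyc_in_H1 ij by simp
  then show "Theta G T x (f \<circ> g) $$ (i, j) = (Theta G T x f * Theta G T x g) $$ (i, j)"
    using ij by (simp add: Theta_eq[OF f] Theta_eq[OF g] Theta_eq[OF aut_comp[OF f g]]
        scalar_prod_def lessThan_atLeast0 mult.commute)
qed (simp_all add: Theta_eq[OF f] Theta_eq[OF g] Theta_eq[OF aut_comp[OF f g]])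

lemma Theta_id: "Theta G T x id = 1\<^sub>m (betti G)"
  by (rule eq_matI)
    (simp_all add: Theta_eq[OF id_in_aut] H1_map_id cyc_in_H1 cyc_at_x of_bool_def eq_commute)

lemma Theta_in_U_group:
  assumes f: "f \<in> carrier (aut_group G)"
  shows "Theta G T x f \<in> carrier (U_group (betti G))"
proof -
  let ?g = "Hilbert_Choice.inv f"
  have carrier: "Theta G T x f \<in> carrier_mat (betti G) (betti G)"
    "Theta G T x ?g \<in> carrier_mat (betti G) (betti G)"
    by (simp_all add: Theta_eq[OF f] Theta_eq[OF aut_inv[OF f]])
  have "f \<circ> ?g = id" using aut_permutes[OF f] by (rule permutes_inv_o)
  then have "Theta G T x f * Theta G T x ?g = 1\<^sub>m (betti G)"
    using Theta_comp[OF f aut_inv[OF f]] Theta_id by simp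
  then have "det (Theta G T x f) * det (Theta G T x ?g) = 1"
    using det_mult[OF carrier] by simp
  then have "det (Theta G T x f) = 1 \<or> det (Theta G T x f) = -1"
    by (auto dest: zmult_eq_1_iff[THEN iffD1])
  with carrier show ?thesis by (simp add: U_group_def)
qed

lemma Theta_hom: "Theta G T x \<in> hom (aut_group G) (U_group (betti G))"
  by (rule homI) (simp_all add: Theta_in_U_group,
      simp_all add: aut_group_def U_group_def Theta_comp[unfolded aut_group_def])

text \<open>
  Equal matrices mean equal maps on homology, since the matrix determines the images of the basis.
  Stating triviality through the pullback instead of the pushforward keeps inverses out of the
  counting argument.
\<close>

lemma Theta_eq_imp_H1_trivial:
  assumes f: "f \<in> carrier (aut_group G)" and g: "g \<in> carrier (aut_group G)"
    and eq: "Theta G T x f = Theta G T x g" and c: "c \<in> H1 G"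
  shows "c \<circ> map_prod (Hilbert_Choice.inv g \<circ> f) (Hilbert_Choice.inv g \<circ> f) = c"
proof -
  have "H1_map G f (cyc j) = H1_map G g (cyc j)" if j: "j < betti G" for j
  proof -
    have in_H1: "H1_map G f (cyc j) \<in> H1 G" "H1_map G g (cyc j) \<in> H1 G"
      using H1_map_in_H1 f g cyc_in_H1[OF j] by blast+
    have "H1_map G f (cyc j) (x i) = H1_map G g (cyc j) (x i)" if "i < betti G" for i
      using arg_cong[OF eq, of "\<lambda>M. M $$ (i, j)"] that j by (simp add: Theta_eq[OF f] Theta_eq[OF g])
    then show ?thesis
      by (subst H1_expansion[OF in_H1(1)], subst H1_expansion[OF in_H1(2)]) simp
  qed
  then have "H1_map G f c = H1_map G g c"
    by (simp add: fun_eq_iff H1_map_expansion[OF f c] H1_map_expansion[OF g c])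
  then have same: "c (map_prod (Hilbert_Choice.inv f) (Hilbert_Choice.inv f) e)
      = c (map_prod (Hilbert_Choice.inv g) (Hilbert_Choice.inv g) e)" for e
    using c by (simp add: H1_map_def) (metis comp_apply)
  show ?thesis
  proof
    fix d
    have "map_prod (Hilbert_Choice.inv f) (Hilbert_Choice.inv f) (map_prod f f d) = d"
      using permutes_inverses(2)[OF aut_permutes[OF f]] by (cases d) simp
    then show "(c \<circ> map_prod (Hilbert_Choice.inv g \<circ> f) (Hilbert_Choice.inv g \<circ> f)) d = c d"
      using same[of "map_prod f f d"] by (simp add: prod.map_comp)
  qed
qed

end

section \<open>Automorphisms acting trivially on homology\<close>

text \<open>
  The Lefschetz trace formula in disguise. For a map that induces the identity on \<open>H\<^sub>0\<close> and \<open>H\<^sub>1\<close>,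
  the Lefschetz number equals the Euler characteristic: fixed vertices minus edges fixed with
  their orientation plus flipped edges is vertices minus edges. Cancelling what is
  fixed leaves an equation between moved vertices and moved edges; the factor 2 appears because darts are counted in place of edges.

  Triviality on homology provides a chain homotopy \<open>\<psi>\<close> between the pullback along \<open>h\<close> and the
  identity, up to a term at the base vertex \<open>r\<close>: the difference \<open>\<psi> v\<close> between the pullback of a walk
  from \<open>r\<close> to \<open>v\<close> and the walk itself does not depend on the choice of the walk.
  The formula comes from evaluating \<open>S\<close>, the sum of \<open>\<psi> (snd d) d\<close> over all darts \<open>d\<close>, twice:
  grouped by head it is a sum of boundaries, one for each vertex; grouped with the
  reverse dart it is a sum of differences of \<open>\<psi>\<close> along edges.
\<close>

lemma (in pair_graph) lefschetz_count:
  assumes conn: "connected G" and h: "h \<in> carrier (aut_group G)"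
    and trivial: "\<And>c. c \<in> H1 G \<Longrightarrow> c \<circ> map_prod h h = c"
  shows "2 * card {v \<in> pverts G. h v \<noteq> v} =
    card {d \<in> parcs G. map_prod h h d \<noteq> d} + card {d \<in> parcs G. map_prod h h d = prod.swap d}"
proof -
  let ?h = "map_prod h h"
  have h_swap: "?h (prod.swap d) = prod.swap (?h d)" for d by (cases d) simp
  have perm: "h permutes pverts G" using h by (rule aut_permutes)
  obtain r where r: "r \<in> pverts G"
    using conn by (auto simp: connected_conv)
  have "\<forall>v\<in>pverts G. \<exists>p. awalk r p v"
    using connected_imp_apath[OF conn r] awalkI_apath by blast
  then obtain w where w: "\<And>v. v \<in> pverts G \<Longrightarrow> awalk r (w v) v" by metis
  define \<psi> where "\<psi> v d = chain_of_walk (w v) (?h d) - chain_of_walk (w v) d" for v d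
  define S where "S = (\<Sum>d\<in>parcs G. \<psi> (snd d) d)"

  have boundary: "boundary1 G (\<psi> v) v = of_bool (h v = v) - 1 - (of_bool (h v = r) - of_bool (v = r))"
    if v: "v \<in> pverts G" for v
  proof -
    have "\<psi> v = (\<lambda>d. (chain_of_walk (w v) \<circ> ?h) d - chain_of_walk (w v) d)"
      by (simp add: \<psi>_def fun_eq_iff)
    then have "boundary1 G (\<psi> v) v
        = boundary1 G (chain_of_walk (w v)) (h v) - boundary1 G (chain_of_walk (w v)) v"
      using boundary1_pullback[OF h] by (simp only: boundary1_diff)
    also have "\<dots> = (of_bool (h v = v) - of_bool (h v = r)) - (of_bool (v = v) - of_bool (v = r))"
      by (simp only: boundary1_chain_of_walk[OF w[OF v]])
    finally show ?thesis by simp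
  qed
  have "S = (\<Sum>v\<in>pverts G. \<Sum>d\<in>{d \<in> parcs G. snd d = v}. \<psi> (snd d) d)"
    unfolding S_def using pair_finite_verts pair_finite_arcs wellformed'
    by (intro sum.group[symmetric]) auto
  also have "\<dots> = (\<Sum>v\<in>pverts G. boundary1 G (\<psi> v) v)"
    by (intro sum.cong refl) (auto simp: boundary1_def in_arcs_def)
  also have "\<dots> = (\<Sum>v\<in>pverts G. of_bool (h v = v) - 1)
      - ((\<Sum>v\<in>pverts G. of_bool (h v = r)) - (\<Sum>v\<in>pverts G. of_bool (v = r)))"
    by (simp add: boundary sum_subtractf)
  \<comment> \<open>The contributions of the base vertex cancel, as \<open>h\<close> takes the value \<open>r\<close> exactly once.\<close>
  also have "(\<Sum>v\<in>pverts G. of_bool (h v = r) :: int) = (\<Sum>v\<in>pverts G. of_bool (v = r))"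
    using sum.permute[OF perm, of "\<lambda>v. of_bool (v = r) :: int"] by (simp add: comp_def)
  also have "(\<Sum>v\<in>pverts G. of_bool (h v = v) - 1) = (\<Sum>v\<in>pverts G. - of_bool (h v \<noteq> v) :: int)"
    by (intro sum.cong) auto
  also have "\<dots> = - int (card {v \<in> pverts G. h v \<noteq> v})"
    using pair_finite_verts by (simp add: sum_negf Int_def)
  finally have vertices: "S = - int (card {v \<in> pverts G. h v \<noteq> v})" by simp

  have edge: "\<psi> (snd d) d - \<psi> (fst d) d = - of_bool (?h d \<noteq> d) - of_bool (?h d = prod.swap d)"
    if d: "d \<in> parcs G" for d
  proof -
    \<comment> \<open>Two walks from \<open>r\<close> to the head of \<open>d\<close>, one of them ending with \<open>d\<close>,
      differ by a 1-cycle, on which \<open>h\<close> acts trivially.\<close>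
    let ?k = "\<lambda>e. chain_of_walk (w (fst d) @ [d]) e - chain_of_walk (w (snd d)) e"
    have ends: "fst d \<in> pverts G" "snd d \<in> pverts G"
      using d arc_fst_in_verts arc_snd_in_verts by auto
    have "awalk r (w (fst d) @ [d]) (snd d)"
      using w[OF ends(1)] d ends by (intro awalk_appendI[of r _ "fst d"]) (simp_all add: awalk_simps)
    then have "?k \<in> H1 G" using w[OF ends(2)] by (rule walks_with_same_ends_in_H1)
    then have "?k (?h d) = ?k d" using fun_cong[OF trivial, of ?k d] by (simp only: comp_apply)
    moreover have "d \<noteq> prod.swap d" using swap_neq_dart[OF d] by metis
    ultimately have "\<psi> (snd d) d - \<psi> (fst d) d = of_bool (?h d = d) - of_bool (?h d = prod.swap d) - 1"
      unfolding \<psi>_def chain_of_walk_append chain_of_walk_Cons chain_of_walk_Nil by simp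
    then show ?thesis by (simp add: of_bool_def)
  qed
  have "bij_betw prod.swap (parcs G) (parcs G)"
    by (intro bij_betwI[where g = prod.swap]) (auto simp: swap_in_parcs_iff simp del: swap_simp)
  then have "(\<Sum>d\<in>parcs G. \<psi> (fst d) d) = (\<Sum>d\<in>parcs G. \<psi> (fst (prod.swap d)) (prod.swap d))"
    by (rule sum.reindex_bij_betw[symmetric])
  also have "\<dots> = (\<Sum>d\<in>parcs G. - \<psi> (snd d) d)"
  proof (rule sum.cong[OF refl])
    fix d
    have "chain_of_walk p (prod.swap e) = - chain_of_walk p e" for p :: "('a \<times> 'a) list" and e
      by (simp add: chain_of_walk_def)
    then show "\<psi> (fst (prod.swap d)) (prod.swap d) = - \<psi> (snd d) d"
      unfolding \<psi>_def h_swap by simp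
  qed
  finally have "2 * S = (\<Sum>d\<in>parcs G. \<psi> (snd d) d - \<psi> (fst d) d)"
    by (simp add: S_def sum_subtractf sum_negf)
  also have "\<dots> = (\<Sum>d\<in>parcs G. - of_bool (?h d \<noteq> d) - of_bool (?h d = prod.swap d))"
    using edge by (intro sum.cong) auto
  also have "\<dots> = - int (card {d \<in> parcs G. ?h d \<noteq> d} + card {d \<in> parcs G. ?h d = prod.swap d})"
    using pair_finite_arcs by (simp add: sum_subtractf sum_negf Int_def)
  finally show ?thesis using vertices by linarith
qed

text \<open>
  Let \<open>W\<close> be the set of moved vertices, \<open>M\<close> the moved darts and \<open>D\<close> the darts that start in \<open>W\<close>. The
  Lefschetz count gives \<open>card M \<le> 2 * card W\<close>, while \<open>D \<subseteq> M\<close> and the degree bound give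
  \<open>2 * card W \<le> card D \<le> card M\<close>. So there is equality throughout: every vertex of \<open>W\<close> has degree
  exactly 2, and a dart that ends in \<open>W\<close> also starts there. By connectedness \<open>W\<close> is empty or
  contains all vertices.
\<close>

lemma (in pair_graph) H1_trivial_imp_id_or_simple_cycle:
  assumes conn: "connected G" and h: "h \<in> carrier (aut_group G)"
    and trivial: "\<And>c. c \<in> H1 G \<Longrightarrow> c \<circ> map_prod h h = c"
    and no_leaf: "\<forall>v \<in> pverts G. out_degree G v \<noteq> 1"
  shows "h = id \<or> simple_cycle G"
proof (rule disjCI)
  assume not_cycle: "\<not> simple_cycle G"
  define W where "W = {v \<in> pverts G. h v \<noteq> v}"
  define M where "M = {d \<in> parcs G. map_prod h h d \<noteq> d}"
  define D where "D = {d \<in> parcs G. fst d \<in> W}"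
  have perm: "h permutes pverts G" using h by (rule aut_permutes)
  have fin: "finite W" "finite M" using pair_finite_verts pair_finite_arcs by (auto simp: W_def M_def)
  have deg: "out_degree G v \<ge> 2" if v: "v \<in> W" for v
  proof -
    \<comment> \<open>A connected graph with an isolated vertex has only that vertex, which is then fixed.\<close>
    have "out_degree G v \<noteq> 0"
    proof
      assume "out_degree G v = 0"
      then have "out_arcs G v = {}"
        using finite_out_arcs by (simp add: out_degree_def)
      then have "{v} = pverts G"
        using v by (intro connected_closed_eq_verts[OF conn]) (auto simp: out_arcs_def W_def)
      moreover have "h v \<in> pverts G" "h v \<noteq> v"
        using v permutes_in_image[OF perm] by (auto simp: W_def)
      ultimately show False by auto
    qed
    moreover have "out_degree G v \<noteq> 1" using no_leaf v by (simp add: W_def)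
    ultimately show ?thesis by linarith
  qed
  have "D \<subseteq> M" by (auto simp: D_def M_def W_def)
  have card_D: "card D = (\<Sum>v\<in>W. out_degree G v)"
  proof -
    have "(\<Sum>d\<in>D. 1 :: nat) = (\<Sum>v\<in>W. \<Sum>d\<in>{d \<in> D. fst d = v}. 1)"
      using fin finite_subset[OF \<open>D \<subseteq> M\<close>] by (intro sum.group[symmetric]) (auto simp: D_def)
    also have "\<dots> = (\<Sum>v\<in>W. out_degree G v)"
      by (intro sum.cong refl) (auto simp: D_def out_degree_def out_arcs_def intro!: arg_cong[of _ _ card])
    finally show ?thesis by simp
  qed
  have "2 * card W = (\<Sum>v\<in>W. 2)" by simp
  also have "\<dots> \<le> card D" unfolding card_D using deg by (intro sum_mono)
  finally have "2 * card W \<le> card D" .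
  moreover have "card D \<le> card M" using \<open>D \<subseteq> M\<close> fin by (intro card_mono)
  moreover have "card M \<le> 2 * card W"
    using lefschetz_count[OF conn h trivial] by (simp add: W_def M_def)
  ultimately have eq: "card D = card M" "card D = 2 * card W" by linarith+
  then have "D = M" using \<open>D \<subseteq> M\<close> fin by (intro card_subset_eq)
  have closed: "b \<in> W" if "(a, b) \<in> parcs G" "a \<in> W" for a b
  proof -
    \<comment> \<open>The dart back to the moved vertex \<open>a\<close> is moved, so it lies in \<open>M = D\<close> and starts in \<open>W\<close>.\<close>
    have "(b, a) \<in> M" using that arcs_symmetric by (auto simp: M_def W_def)
    then show ?thesis using \<open>D = M\<close> by (auto simp: D_def)
  qed
  have deg_eq: "out_degree G v = 2" if "v \<in> W" for v
  proof (rule ccontr)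
    assume "out_degree G v \<noteq> 2"
    then have "2 < out_degree G v" using deg[OF that] by linarith
    then have "(\<Sum>v\<in>W. 2) < (\<Sum>v\<in>W. out_degree G v)"
      using deg that fin by (intro sum_strict_mono_ex1) auto
    then show False using eq(2) card_D by simp
  qed
  have "W = {}"
  proof (rule ccontr)
    assume "W \<noteq> {}"
    then have "W = pverts G"
      using closed by (intro connected_closed_eq_verts[OF conn]) (auto simp: W_def)
    then show False
      using not_cycle deg_eq conn pair_graph by (simp add: simple_cycle_def)
  qed
  then show "h = id"
    using permutes_not_in[OF perm] by (fastforce simp: W_def)
qed

theorem proposition5:
  fixes G T :: "'a pair_pre_digraph" and x :: "nat \<Rightarrow> 'a \<times> 'a"
  assumes "pair_graph G"
    and "connected G"
    and "\<forall>v \<in> pverts G. out_degree G v \<noteq> 1"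
    and "undirected_spanning_tree T G"
    and "cotree_darts G T x"
  shows "Theta G T x \<in> mon (aut_group G) (U_group (betti G)) \<or> simple_cycle G"
proof (rule disjCI)
  assume not_cycle: "\<not> simple_cycle G"
  interpret pair_graph G by fact
  interpret graph_with_cotree_darts G T x
    using assms(4,5) by unfold_locales
  have "f = g"
    if f: "f \<in> carrier (aut_group G)" and g: "g \<in> carrier (aut_group G)"
      and eq: "Theta G T x f = Theta G T x g" for f g
  proof -
    have "Hilbert_Choice.inv g \<circ> f = id"
      using H1_trivial_imp_id_or_simple_cycle[OF assms(2) aut_comp[OF aut_inv[OF g] f]
          Theta_eq_imp_H1_trivial[OF f g eq] assms(3)] not_cycle by blast
    then have "g \<circ> (Hilbert_Choice.inv g \<circ> f) = g" by simp
    then show "f = g"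
      using permutes_inv_o(1)[OF aut_permutes[OF g]] by (simp flip: comp_assoc)
  qed
  then show "Theta G T x \<in> mon (aut_group G) (U_group (betti G))"
    using Theta_hom by (auto simp: mon_def intro: inj_onI)
qed

end
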